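(* Let $F: X\to[-\infty,\infty]$ and $G_*: Y\to[-\infty,\infty]$ be convex, proper, and lower semicontinuous; let $K\in C^1(X\times Y)$; and let both $J_X\in C(X)$ and $J_Y\in C(Y)$ be convex and Gâteaux-differentiable. Suppose for some $\hat u\in H^{-1}(0)$ that: (i) the second-order growth condition $(C^2)$ at $\bar u=\hat u$ holds with $\mathcal{G}(\cdot,\hat u)\ge 0$ within $\Omega_{\hat u}\subset X\times Y$; and (ii) $B^0$ is semi-elliptic within some $\Omega\subset X\times Y$ with $\hat u\in\Omega$. Let $\{u^{k+1}\}_{k\in\mathbb{N}}$ be generated by the PDBS for any initial $u^0$, and suppose $\{u^k\}_{k\in\mathbb{N}}\subset\Omega\cap\Omega_{\hat u}$. Then $\mathcal{G}(u^{k+1},\hat u)\to 0$ as $k\to\infty$. In particular, if $\mathcal{G}(u,\hat u)\ge\|P(u-\hat u)\|_Z^2$ (for $u\in\Omega_{\hat u}$) for some bounded linear operator $P: X\times Y\to Z$ into a Banach space $Z$, then $Pu^N\to P\hat u$ strongly in $Z$ as $N\to\infty$, and the ergodic sequence $\tilde u_P^N:=\frac1N\sum_{k=0}^{N-1}Pu^{k+1}$ converges to $P\hat u$ at rate $O(1/N)$.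
   Context: All spaces are real; $X,Y$ are Banach spaces, $u=(x,y)\in X\times Y$, $u^k=(x^k,y^k)$, $\hat u=(\hat x,\hat y)$, etc. $\langle\cdot|\cdot\rangle$ is the dual pairing, $\partial$ the convex subdifferential, $D$ the Gâteaux derivative, $D_xK,D_yK$ the partial derivatives of $K$. The set-valued map $H: X\times Y\rightrightarrows X^*\times Y^*$ is $H(x,y)=\big(\partial F(x)+D_xK(x,y)\big)\times\big(\partial G_*(y)-D_yK(x,y)\big)$, and $H^{-1}(0)=\{u: 0\in H(u)\}$. For a Gâteaux-differentiable function $J$ the Bregman divergence is $B_J(z,x)=J(z)-J(x)-\langle DJ(x)|z-x\rangle$. Set $J^0(x,y)=J_X(x)+J_Y(y)-K(x,y)$ and $B^0=B_{J^0}$. $B^0$ is semi-elliptic within $\Omega$ if $B^0(u',u)\ge 0$ for all $u,u'\in\Omega$. PDBS (primal-dual Bregman-proximal splitting): given $u^0$, for each $k\in\mathbb{N}$ the iterate $u^{k+1}=(x^{k+1},y^{k+1})$ solves $$DJ_X(x^k)-D_xK(x^k,y^k)\in DJ_X(x^{k+1})+\partial F(x^{k+1}),$$ $$DJ_Y(y^k)-D_yK(x^k,y^k)\in DJ_Y(y^{k+1})+\partial G_*(y^{k+1})-2D_yK(x^{k+1},y^{k+1}).$$ Condition $(C^2)$ at $\bar u=(\bar x,\bar y)$ holds within $\Omega_{\bar u}$ with $\mathcal{G}(\cdot,\bar u)$ (real-valued) if for all $u=(x,y)\in\Omega_{\bar u}$, $x^*\in\partial F(x)$, $y^*\in\partial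 G_*(y)$, $$\langle x^*+D_xK(x,y)|x-\bar x\rangle+\langle y^*-D_yK(x,y)|y-\bar y\rangle\ge\mathcal{G}(u,\bar u).$$
   Formalization: The O(1/N) rate of the ergodic sequence is stated for the squared norm of its distance to Pû, since for the unsquared norm the claim fails (e.g. in ℓ² with F=½Σx_i²/i, K=0, P=A^{1/2}, x⁰_i=i^{-0.6}); strong convergence of the ergodic sequence is stated too. *)

theory Defs
  imports "HOL-Analysis.Analysis" "HOL-Library.Landau_Symbols"
begin

type_synonym 'a dual = "'a \<Rightarrow>\<^sub>L real"

(* Convexity is stated through the epigraph, which avoids \<infinity> - \<infinity>. *)
definition ereal_convex :: "('a::real_vector \<Rightarrow> ereal) \<Rightarrow> bool" where
  "ereal_convex F \<longleftrightarrow> convex {(x, r::real). F x \<le> ereal r}"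

definition proper_fun :: "('a \<Rightarrow> ereal) \<Rightarrow> bool" where
  "proper_fun F \<longleftrightarrow> (\<forall>x. F x \<noteq> -\<infinity>) \<and> (\<exists>x. F x \<noteq> \<infinity>)"

definition lsc_fun :: "('a::topological_space \<Rightarrow> ereal) \<Rightarrow> bool" where
  "lsc_fun F \<longleftrightarrow> (\<forall>x. F x \<le> Liminf (at x) F)"

(* For proper F the set is empty wherever F x = \<infinity>. *)
definition subdiff :: "('a::real_normed_vector \<Rightarrow> ereal) \<Rightarrow> 'a \<Rightarrow> 'a dual set" where
  "subdiff F x = {p. \<forall>z. F x + ereal (blinfun_apply p (z - x)) \<le> F z}"

definition has_gateaux_derivative ::
    "('a::real_normed_vector \<Rightarrow> real) \<Rightarrow> 'a dual \<Rightarrow> 'a \<Rightarrow> bool" where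
  "has_gateaux_derivative J p x \<longleftrightarrow>
     (\<forall>h. ((\<lambda>t. (J (x + t *\<^sub>R h) - J x) / t) \<longlongrightarrow> blinfun_apply p h) (at 0))"

definition gateaux_differentiable :: "('a::real_normed_vector \<Rightarrow> real) \<Rightarrow> bool" where
  "gateaux_differentiable J \<longleftrightarrow> (\<forall>x. \<exists>p. has_gateaux_derivative J p x)"

definition gateaux_deriv :: "('a::real_normed_vector \<Rightarrow> real) \<Rightarrow> 'a \<Rightarrow> 'a dual" where
  "gateaux_deriv J x = (THE p. has_gateaux_derivative J p x)"

lemma gateaux_deriv_eqI:
  assumes "has_gateaux_derivative J p x"
  shows "gateaux_deriv J x = p"
  unfolding gateaux_deriv_def
proof (rule the_equality)
  fix q assume "has_gateaux_derivative J q x"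
  then have "blinfun_apply q h = blinfun_apply p h" for h
    using assms LIM_unique unfolding has_gateaux_derivative_def by blast
  then show "q = p" by (rule blinfun_eqI)
qed fact

definition C1_fun :: "('a::real_normed_vector \<Rightarrow> real) \<Rightarrow> bool" where
  "C1_fun K \<longleftrightarrow> (\<exists>K' :: 'a \<Rightarrow> 'a dual.
     (\<forall>u. (K has_derivative blinfun_apply (K' u)) (at u)) \<and> continuous_on UNIV K')"

definition Dx :: "('x::real_normed_vector \<times> 'y::real_normed_vector \<Rightarrow> real) \<Rightarrow> 'x \<times> 'y \<Rightarrow> 'x dual" where
  "Dx K u = gateaux_deriv (\<lambda>x. K (x, snd u)) (fst u)"

definition Dy :: "('x::real_normed_vector \<times> 'y::real_normed_vector \<Rightarrow> real) \<Rightarrow> 'x \<times> 'y \<Rightarrow> 'y dual" where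
  "Dy K u = gateaux_deriv (\<lambda>y. K (fst u, y)) (snd u)"

definition Hmap ::
    "('x::real_normed_vector \<Rightarrow> ereal) \<Rightarrow> ('y::real_normed_vector \<Rightarrow> ereal) \<Rightarrow> ('x \<times> 'y \<Rightarrow> real)
      \<Rightarrow> 'x \<times> 'y \<Rightarrow> ('x dual \<times> 'y dual) set" where
  "Hmap F Gs K u = (Dx K u +o subdiff F (fst u)) \<times> ((- Dy K u) +o subdiff Gs (snd u))"

definition Hzeros ::
    "('x::real_normed_vector \<Rightarrow> ereal) \<Rightarrow> ('y::real_normed_vector \<Rightarrow> ereal) \<Rightarrow> ('x \<times> 'y \<Rightarrow> real)
      \<Rightarrow> ('x \<times> 'y) set" where
  "Hzeros F Gs K = {u. (0, 0) \<in> Hmap F Gs K u}"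

definition bregman :: "('a::real_normed_vector \<Rightarrow> real) \<Rightarrow> 'a \<Rightarrow> 'a \<Rightarrow> real" where
  "bregman J z x = J z - J x - blinfun_apply (gateaux_deriv J x) (z - x)"

definition J0 :: "('x \<Rightarrow> real) \<Rightarrow> ('y \<Rightarrow> real) \<Rightarrow> ('x \<times> 'y \<Rightarrow> real) \<Rightarrow> 'x \<times> 'y \<Rightarrow> real" where
  "J0 JX JY K u = JX (fst u) + JY (snd u) - K u"

definition semi_elliptic :: "('a \<Rightarrow> 'a \<Rightarrow> real) \<Rightarrow> 'a set \<Rightarrow> bool" where
  "semi_elliptic B \<Omega> \<longleftrightarrow> (\<forall>u\<in>\<Omega>. \<forall>u'\<in>\<Omega>. B u' u \<ge> 0)"

definition pdbs ::
    "('x::real_normed_vector \<Rightarrow> ereal) \<Rightarrow> ('y::real_normed_vector \<Rightarrow> ereal) \<Rightarrow> ('x \<times> 'y \<Rightarrow> real)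
      \<Rightarrow> ('x \<Rightarrow> real) \<Rightarrow> ('y \<Rightarrow> real) \<Rightarrow> (nat \<Rightarrow> 'x \<times> 'y) \<Rightarrow> bool" where
  "pdbs F Gs K JX JY u \<longleftrightarrow> (\<forall>k.
     gateaux_deriv JX (fst (u k)) - Dx K (u k)
       \<in> gateaux_deriv JX (fst (u (Suc k))) +o subdiff F (fst (u (Suc k))) \<and>
     gateaux_deriv JY (snd (u k)) - Dy K (u k)
       \<in> (gateaux_deriv JY (snd (u (Suc k))) - 2 *\<^sub>R Dy K (u (Suc k)))
           +o subdiff Gs (snd (u (Suc k))))"

definition second_order_growth ::
    "('x::real_normed_vector \<Rightarrow> ereal) \<Rightarrow> ('y::real_normed_vector \<Rightarrow> ereal) \<Rightarrow> ('x \<times> 'y \<Rightarrow> real)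
      \<Rightarrow> ('x \<times> 'y) set \<Rightarrow> ('x \<times> 'y \<Rightarrow> 'x \<times> 'y \<Rightarrow> real) \<Rightarrow> 'x \<times> 'y \<Rightarrow> bool" where
  "second_order_growth F Gs K \<Omega> \<G> ubar \<longleftrightarrow>
     (\<forall>u\<in>\<Omega>. \<forall>p\<in>subdiff F (fst u). \<forall>q\<in>subdiff Gs (snd u).
        blinfun_apply (p + Dx K u) (fst u - fst ubar)
          + blinfun_apply (q - Dy K u) (snd u - snd ubar) \<ge> \<G> u ubar)"

end

theory Submission
  imports Defs
begin

text \<open>
  The PDBS is a Bregman proximal point method for \<open>H\<close>: each step reads
  \<open>DJ\<^sup>0(u\<^sup>k) - DJ\<^sup>0(u\<^sup>k\<^sup>+\<^sup>1) \<in> H(u\<^sup>k\<^sup>+\<^sup>1)\<close>. Testing this inclusion by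
  \<open>u\<^sup>k\<^sup>+\<^sup>1 - uhat\<close> and applying the three-point identity for \<open>B\<^sup>0\<close> together with \<open>(C\<^sup>2)\<close> gives
  \<open>\<G>(u\<^sup>k\<^sup>+\<^sup>1) + B\<^sup>0(u\<^sup>k\<^sup>+\<^sup>1, u\<^sup>k) \<le> B\<^sup>0(uhat, u\<^sup>k) - B\<^sup>0(uhat, u\<^sup>k\<^sup>+\<^sup>1)\<close>. Semi-ellipticity lets this
  telescope, so the growth terms are summable, with sum at most \<open>B\<^sup>0(uhat, u\<^sup>0)\<close>. The ergodic rate
  follows from convexity of the squared norm.
\<close>

lemma has_gateaux_derivative_gateaux_deriv:
  assumes "gateaux_differentiable J"
  shows "has_gateaux_derivative J (gateaux_deriv J x) x"
  using assms gateaux_deriv_eqI unfolding gateaux_differentiable_def by metis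

text \<open>Chain rule along the line \<open>t \<mapsto> x + t *\<^sub>R h\<close>: the scalar
  derivative at 0, written as a limit, is exactly the directional difference quotient.\<close>

lemma has_derivative_imp_has_gateaux_derivative:
  assumes "(J has_derivative blinfun_apply p) (at x)"
  shows "has_gateaux_derivative J p x"
  unfolding has_gateaux_derivative_def
proof
  fix h
  have "((\<lambda>t::real. x + t *\<^sub>R h) has_derivative (\<lambda>t. t *\<^sub>R h)) (at 0)"
    by (auto intro!: derivative_eq_intros)
  moreover have "(J has_derivative blinfun_apply p) (at (x + (0::real) *\<^sub>R h))"
    using assms by simp
  ultimately have "((\<lambda>t. J (x + t *\<^sub>R h)) has_derivative (\<lambda>t. blinfun_apply p (t *\<^sub>R h))) (at 0)"
    by (rule has_derivative_compose)
  then have "((\<lambda>t. J (x + t *\<^sub>R h)) has_field_derivative blinfun_apply p h) (at 0)"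
    by (simp add: has_field_derivative_def blinfun.scaleR_right mult.commute[of _ "blinfun_apply p h"])
  then show "((\<lambda>t. (J (x + t *\<^sub>R h) - J x) / t) \<longlongrightarrow> blinfun_apply p h) (at 0)"
    by (simp add: DERIV_def)
qed

text \<open>\<open>Dx\<close> and \<open>Dy\<close> are defined as Gateaux derivatives along slices.
  Uniqueness of these identifies them with the restrictions of the Frechet derivative to the two
  factors, and linearity recombines the restrictions.\<close>

lemma C1_fun_has_derivative:
  assumes "C1_fun K"
  shows "(K has_derivative (\<lambda>h. blinfun_apply (Dx K u) (fst h) + blinfun_apply (Dy K u) (snd h))) (at u)"
proof -
  obtain K' where K': "(K has_derivative blinfun_apply (K' u)) (at u)"
    using assms unfolding C1_fun_def by blast
  define px where "px = Blinfun (\<lambda>h. blinfun_apply (K' u) (h, 0))"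
  define py where "py = Blinfun (\<lambda>h. blinfun_apply (K' u) (0, h))"
  have px: "blinfun_apply px = (\<lambda>h. blinfun_apply (K' u) (h, 0))"
    unfolding px_def
    by (intro bounded_linear_Blinfun_apply bounded_linear_compose[OF blinfun.bounded_linear_right]
        bounded_linear_Pair bounded_linear_ident bounded_linear_zero)
  have py: "blinfun_apply py = (\<lambda>h. blinfun_apply (K' u) (0, h))"
    unfolding py_def
    by (intro bounded_linear_Blinfun_apply bounded_linear_compose[OF blinfun.bounded_linear_right]
        bounded_linear_Pair bounded_linear_ident bounded_linear_zero)
  have "((\<lambda>x. K (x, snd u)) has_derivative blinfun_apply px) (at (fst u))"
    unfolding px
    by (rule has_derivative_compose[where g = K and f = "\<lambda>x. (x, snd u)"])
       (auto intro!: derivative_eq_intros simp: K')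
  then have Dx: "Dx K u = px"
    unfolding Dx_def by (intro gateaux_deriv_eqI has_derivative_imp_has_gateaux_derivative)
  have "((\<lambda>y. K (fst u, y)) has_derivative blinfun_apply py) (at (snd u))"
    unfolding py
    by (rule has_derivative_compose[where g = K and f = "\<lambda>y. (fst u, y)"])
       (auto intro!: derivative_eq_intros simp: K')
  then have Dy: "Dy K u = py"
    unfolding Dy_def by (intro gateaux_deriv_eqI has_derivative_imp_has_gateaux_derivative)
  have "blinfun_apply (K' u) h = blinfun_apply px (fst h) + blinfun_apply py (snd h)" for h
    unfolding px py blinfun.add_right[symmetric] by simp
  then have "blinfun_apply (K' u) =
      (\<lambda>h. blinfun_apply (Dx K u) (fst h) + blinfun_apply (Dy K u) (snd h))"
    unfolding Dx Dy by blast
  with K' show ?thesis by simp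
qed

text \<open>\<open>JX\<close> and \<open>JY\<close> are only assumed Gateaux differentiable, so the
  argument stays with difference quotients: the quotient of \<open>J0\<close> in direction
  \<open>h\<close> splits into one quotient each for \<open>JX\<close>, \<open>JY\<close> and
  \<open>K\<close>.\<close>

lemma gateaux_deriv_J0:
  assumes "C1_fun K" "gateaux_differentiable JX" "gateaux_differentiable JY"
  shows "blinfun_apply (gateaux_deriv (J0 JX JY K) u) h =
    blinfun_apply (gateaux_deriv JX (fst u) - Dx K u) (fst h)
    + blinfun_apply (gateaux_deriv JY (snd u) - Dy K u) (snd h)"
proof -
  define k where "k = (Dx K u o\<^sub>L fst_blinfun) + (Dy K u o\<^sub>L snd_blinfun)"
  define p where "p = (gateaux_deriv JX (fst u) o\<^sub>L fst_blinfun)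
    + (gateaux_deriv JY (snd u) o\<^sub>L snd_blinfun) - k"
  have "blinfun_apply k = (\<lambda>h. blinfun_apply (Dx K u) (fst h) + blinfun_apply (Dy K u) (snd h))"
    by (simp add: k_def fun_eq_iff blinfun.add_left)
  then have K: "has_gateaux_derivative K k u"
    using C1_fun_has_derivative[OF assms(1), of u] by (intro has_derivative_imp_has_gateaux_derivative) simp
  have "has_gateaux_derivative (J0 JX JY K) p u"
    unfolding has_gateaux_derivative_def
  proof
    fix h
    have "((\<lambda>t. (JX (fst u + t *\<^sub>R fst h) - JX (fst u)) / t
        + (JY (snd u + t *\<^sub>R snd h) - JY (snd u)) / t
        - (K (u + t *\<^sub>R h) - K u) / t) \<longlongrightarrow>
        blinfun_apply (gateaux_deriv JX (fst u)) (fst h)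
        + blinfun_apply (gateaux_deriv JY (snd u)) (snd h) - blinfun_apply k h) (at 0)"
      using K has_gateaux_derivative_gateaux_deriv[OF assms(2), of "fst u"]
        has_gateaux_derivative_gateaux_deriv[OF assms(3), of "snd u"]
      unfolding has_gateaux_derivative_def by (intro tendsto_diff tendsto_add) blast+
    then show "((\<lambda>t. (J0 JX JY K (u + t *\<^sub>R h) - J0 JX JY K u) / t) \<longlongrightarrow> blinfun_apply p h) (at 0)"
      by (simp add: J0_def p_def blinfun.add_left blinfun.diff_left diff_divide_distrib
          add_divide_distrib algebra_simps)
  qed
  then have "gateaux_deriv (J0 JX JY K) u = p" by (rule gateaux_deriv_eqI)
  then show ?thesis
    by (simp add: p_def k_def blinfun.add_left blinfun.diff_left)
qed

text \<open>The values of \<open>J\<close> cancel, and the two terms with the derivative at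
  \<open>x\<close> merge because \<open>(y - x) - (z - x) = y - z\<close>.\<close>

lemma bregman_three_point:
  "bregman J z x - bregman J z y - bregman J y x =
    blinfun_apply (gateaux_deriv J x) (y - z) - blinfun_apply (gateaux_deriv J y) (y - z)"
  by (simp add: bregman_def blinfun.diff_right)

lemma pdbs_step:
  assumes "C1_fun K" "gateaux_differentiable JX" "gateaux_differentiable JY"
    and growth: "second_order_growth F Gs K \<Omega> \<G> ubar"
    and pdbs: "pdbs F Gs K JX JY u"
    and mem: "u (Suc k) \<in> \<Omega>"
  shows "\<G> (u (Suc k)) ubar + bregman (J0 JX JY K) (u (Suc k)) (u k)
    \<le> bregman (J0 JX JY K) ubar (u k) - bregman (J0 JX JY K) ubar (u (Suc k))"
proof -
  let ?v = "u (Suc k)" and ?D = "gateaux_deriv (J0 JX JY K)"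
  obtain p where p: "p \<in> subdiff F (fst ?v)"
    and px: "gateaux_deriv JX (fst (u k)) - Dx K (u k) = gateaux_deriv JX (fst ?v) + p"
    using pdbs unfolding pdbs_def elt_set_plus_def by blast
  obtain q where q: "q \<in> subdiff Gs (snd ?v)"
    and qy: "gateaux_deriv JY (snd (u k)) - Dy K (u k)
      = (gateaux_deriv JY (snd ?v) - 2 *\<^sub>R Dy K ?v) + q"
    using pdbs unfolding pdbs_def elt_set_plus_def by blast
  have "\<G> ?v ubar \<le> blinfun_apply (p + Dx K ?v) (fst ?v - fst ubar)
      + blinfun_apply (q - Dy K ?v) (snd ?v - snd ubar)"
    using growth mem p q unfolding second_order_growth_def by blast
  \<comment> \<open>Here the factor 2 in the dual update pays off: of
    \<open>2 *\<^sub>R Dy K ?v\<close>, one copy is absorbed into the derivative of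
    \<open>J0\<close> at \<open>?v\<close>, and the other leaves \<open>q - Dy K ?v\<close>. In the
    primal component the same difference leaves \<open>p + Dx K ?v\<close>.\<close>
  also have "\<dots> = blinfun_apply (?D (u k)) (?v - ubar) - blinfun_apply (?D ?v) (?v - ubar)"
    unfolding gateaux_deriv_J0[OF assms(1-3)] px qy
    by (simp add: blinfun.add_left blinfun.diff_left blinfun.scaleR_left)
  also have "\<dots> = bregman (J0 JX JY K) ubar (u k) - bregman (J0 JX JY K) ubar ?v
      - bregman (J0 JX JY K) ?v (u k)"
    by (rule bregman_three_point[symmetric])
  finally show ?thesis by simp
qed

lemma tendsto_if_norm_power2_tendsto_0:
  fixes f :: "'a \<Rightarrow> 'b::real_normed_vector"
  assumes "((\<lambda>n. (norm (f n - l))\<^sup>2) \<longlongrightarrow> 0) A"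
  shows "(f \<longlongrightarrow> l) A"
  using tendsto_real_sqrt[OF assms] by (simp add: LIM_zero_iff tendsto_norm_zero_iff)

text \<open>The triangle inequality reduces the claim to real numbers, where Cauchy-Schwarz bounds
  the square of a sum of \<open>N\<close> terms by \<open>N\<close> times the sum of squares; no
  inner product on the space is involved.\<close>

lemma norm_average_power2_le:
  fixes f :: "nat \<Rightarrow> 'a::real_normed_vector"
  assumes "N > 0"
  shows "(norm ((1 / real N) *\<^sub>R (\<Sum>k<N. f k) - l))\<^sup>2 \<le> (\<Sum>k<N. (norm (f k - l))\<^sup>2) / real N"
proof -
  have "(1 / real N) *\<^sub>R (\<Sum>k<N. f k) - l = (1 / real N) *\<^sub>R (\<Sum>k<N. f k - l)"
    using assms by (simp add: sum_subtractf scaleR_diff_right sum_constant_scaleR)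
  then have "(norm ((1 / real N) *\<^sub>R (\<Sum>k<N. f k) - l))\<^sup>2 = (norm (\<Sum>k<N. f k - l))\<^sup>2 / (real N)\<^sup>2"
    by (simp add: power_divide)
  also have "\<dots> \<le> (\<Sum>k<N. norm (f k - l))\<^sup>2 / (real N)\<^sup>2"
    by (intro divide_right_mono power_mono norm_sum) auto
  also have "\<dots> \<le> ((\<Sum>k<N. (norm (f k - l))\<^sup>2) * real N) / (real N)\<^sup>2"
    using sum_squared_le_sum_of_squares[of "\<lambda>k. norm (f k - l)" "{..<N}"]
    by (intro divide_right_mono) (auto simp: mult.commute)
  also have "\<dots> = (\<Sum>k<N. (norm (f k - l))\<^sup>2) / real N"
    using assms by (simp add: power2_eq_square)
  finally show ?thesis .
qed

theorem theorem3:
  fixes F :: "'x::banach \<Rightarrow> ereal"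
    and Gs :: "'y::banach \<Rightarrow> ereal"
    and K :: "'x \<times> 'y \<Rightarrow> real"
    and JX :: "'x \<Rightarrow> real"
    and JY :: "'y \<Rightarrow> real"
    and \<G> :: "'x \<times> 'y \<Rightarrow> 'x \<times> 'y \<Rightarrow> real"
    and uhat :: "'x \<times> 'y"
    and \<Omega> \<Omega>hat :: "('x \<times> 'y) set"
    and u :: "nat \<Rightarrow> 'x \<times> 'y"
  assumes "ereal_convex F" "proper_fun F" "lsc_fun F"
    and "ereal_convex Gs" "proper_fun Gs" "lsc_fun Gs"
    and "C1_fun K"
    and "continuous_on UNIV JX" "convex_on UNIV JX" "gateaux_differentiable JX"
    and "continuous_on UNIV JY" "convex_on UNIV JY" "gateaux_differentiable JY"
    and "uhat \<in> Hzeros F Gs K"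
    and "second_order_growth F Gs K \<Omega>hat \<G> uhat"
    and "\<forall>v\<in>\<Omega>hat. \<G> v uhat \<ge> 0"
    and "semi_elliptic (bregman (J0 JX JY K)) \<Omega>"
    and "uhat \<in> \<Omega>"
    and "pdbs F Gs K JX JY u"
    and "\<forall>k. u k \<in> \<Omega> \<inter> \<Omega>hat"
  shows "(\<lambda>k. \<G> (u (Suc k)) uhat) \<longlonglongrightarrow> 0 \<and>
    (\<forall>P :: ('x \<times> 'y) \<Rightarrow>\<^sub>L 'z::banach.
       (\<forall>v\<in>\<Omega>hat. \<G> v uhat \<ge> (norm (blinfun_apply P (v - uhat)))\<^sup>2) \<longrightarrow>
         (\<lambda>N. blinfun_apply P (u N)) \<longlonglongrightarrow> blinfun_apply P uhat \<and>
         (\<lambda>N. (1 / real N) *\<^sub>R (\<Sum>k<N. blinfun_apply P (u (Suc k)))) \<longlonglongrightarrow> blinfun_apply P uhat \<and>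
         (\<lambda>N. (norm ((1 / real N) *\<^sub>R (\<Sum>k<N. blinfun_apply P (u (Suc k)))
                 - blinfun_apply P uhat))\<^sup>2) \<in> O(\<lambda>N. 1 / real N))"
proof -
  define B where "B = bregman (J0 JX JY K)"
  let ?g = "\<lambda>k. \<G> (u (Suc k)) uhat"
  have mem: "u k \<in> \<Omega>" "u k \<in> \<Omega>hat" for k
    using assms(20) by auto
  have B_nonneg: "B v w \<ge> 0" if "v \<in> \<Omega>" "w \<in> \<Omega>" for v w
    using assms(17) that unfolding B_def semi_elliptic_def by blast
  have g_nonneg: "?g k \<ge> 0" for k
    using assms(16) mem by blast
  have step: "?g k \<le> B uhat (u k) - B uhat (u (Suc k))" for k
    using pdbs_step[OF assms(7,10,13,15,19) mem(2), of k] B_nonneg[OF mem(1) mem(1), of "Suc k" k]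
    by (simp add: B_def)
  have partial_sum: "(\<Sum>k<N. ?g k) \<le> B uhat (u 0)" for N
  proof -
    have "(\<Sum>k<N. ?g k) \<le> (\<Sum>k<N. B uhat (u k) - B uhat (u (Suc k)))"
      by (intro sum_mono step)
    also have "\<dots> = B uhat (u 0) - B uhat (u N)"
      by (rule sum_lessThan_telescope')
    \<comment> \<open>The leftover term \<open>B uhat (u N)\<close> is nonnegative since
      \<open>uhat\<close> and \<open>u N\<close> lie in \<open>\<Omega>\<close>; this makes the
      bound uniform in \<open>N\<close>.\<close>
    also have "\<dots> \<le> B uhat (u 0)"
      using B_nonneg[OF assms(18) mem(1)] by simp
    finally show ?thesis .
  qed
  have "summable ?g"
    using g_nonneg partial_sum by (intro summableI_nonneg_bounded)
  then have g_lim: "?g \<longlonglongrightarrow> 0"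
    by (rule summable_LIMSEQ_zero)
  show ?thesis
  proof (intro conjI allI impI)
    show "?g \<longlonglongrightarrow> 0" by (rule g_lim)
  next
    fix P :: "('x \<times> 'y) \<Rightarrow>\<^sub>L 'z"
    assume P: "\<forall>v\<in>\<Omega>hat. \<G> v uhat \<ge> (norm (blinfun_apply P (v - uhat)))\<^sup>2"
    let ?l = "blinfun_apply P uhat"
    let ?avg = "\<lambda>N. (1 / real N) *\<^sub>R (\<Sum>k<N. blinfun_apply P (u (Suc k)))"
    have P_le: "(norm (blinfun_apply P (u (Suc k)) - ?l))\<^sup>2 \<le> ?g k" for k
      using P mem(2) by (simp add: blinfun.diff_right)
    have "(\<lambda>k. (norm (blinfun_apply P (u (Suc k)) - ?l))\<^sup>2) \<longlonglongrightarrow> 0"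
      using P_le by (intro tendsto_sandwich[OF _ _ tendsto_const g_lim]) auto
    then have "(\<lambda>k. blinfun_apply P (u (Suc k))) \<longlonglongrightarrow> ?l"
      by (rule tendsto_if_norm_power2_tendsto_0)
    \<comment> \<open>The growth terms are taken at \<open>u (Suc k)\<close>, so the limit is first
      obtained for the shifted sequence.\<close>
    then show "(\<lambda>N. blinfun_apply P (u N)) \<longlonglongrightarrow> ?l"
      by (rule LIMSEQ_imp_Suc)
    \<comment> \<open>For \<open>N = 0\<close> division by zero gives \<open>?avg 0 = 0\<close> and
      a right-hand side of 0, so the bound would fail unless \<open>?l = 0\<close>. Both asymptotic
      claims below use it only eventually.\<close>
    have avg_le: "(norm (?avg N - ?l))\<^sup>2 \<le> B uhat (u 0) * (1 / real N)" if "N > 0" for N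
    proof -
      have "(norm (?avg N - ?l))\<^sup>2
          \<le> (\<Sum>k<N. (norm (blinfun_apply P (u (Suc k)) - ?l))\<^sup>2) / real N"
        using that by (rule norm_average_power2_le)
      also have "\<dots> \<le> (\<Sum>k<N. ?g k) / real N"
        by (intro divide_right_mono sum_mono P_le) simp
      also have "\<dots> \<le> B uhat (u 0) / real N"
        by (intro divide_right_mono partial_sum) simp
      finally show ?thesis by simp
    qed
    have ev: "\<forall>\<^sub>F N in sequentially. (norm (?avg N - ?l))\<^sup>2 \<le> B uhat (u 0) * (1 / real N)"
      using eventually_gt_at_top[of 0] by eventually_elim (rule avg_le)
    show "(\<lambda>N. (norm (?avg N - ?l))\<^sup>2) \<in> O(\<lambda>N. 1 / real N)"
      using ev by (intro bigoI[where c = "B uhat (u 0)"]) simp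
    have "(\<lambda>N. B uhat (u 0) * (1 / real N)) \<longlonglongrightarrow> 0"
      by (rule tendsto_mult_right_zero[OF lim_1_over_n])
    then have "(\<lambda>N. (norm (?avg N - ?l))\<^sup>2) \<longlonglongrightarrow> 0"
      using ev by (intro tendsto_sandwich[OF _ ev tendsto_const]) auto
    then show "?avg \<longlonglongrightarrow> ?l"
      by (rule tendsto_if_norm_power2_tendsto_0)
  qed
qed

end
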